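(* Any nonconstant unitary perfect polynomial over $\mathbb{F}_2$ is divisible by $x$ and by $x+1$. In particular, there is no odd nonconstant unitary perfect polynomial over $\mathbb{F}_2$.
   Context: For a nonzero polynomial $A \in \mathbb{F}_2[x]$, a divisor $d$ of $A$ is called unitary if $d$ is monic and $\gcd(d, A/d) = 1$. $\sigma^*(A)$ denotes the sum of all unitary divisors of $A$. The polynomial $A$ is called unitary perfect if $\sigma^*(A) = A$. A polynomial over $\mathbb{F}_2$ is called even if it has some zero in $\mathbb{F}_2$, and odd if it is not even. *)

theory Defs
  imports "HOL-Library.Z2" "HOL-Computational_Algebra.Polynomial"
begin

text \<open>
  The field with two elements is the type \<^typ>\<open>bit\<close>.
  The condition that the gcd of \<open>d\<close> and \<open>A div d\<close> is \<open>1\<close> is expressed by \<^const>\<open>coprime\<close>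
  (all common divisors are units), since \<^typ>\<open>bit poly\<close> has no \<open>gcd\<close> operation in the library.
\<close>

definition unitary_divisor :: "bit poly \<Rightarrow> bit poly \<Rightarrow> bool" where
  "unitary_divisor d A \<longleftrightarrow> d dvd A \<and> lead_coeff d = 1 \<and> coprime d (A div d)"

definition sigma_star :: "bit poly \<Rightarrow> bit poly" where
  "sigma_star A = (\<Sum>d | unitary_divisor d A. d)"

text \<open>The sum above ranges over a finite set for nonzero \<open>A\<close>:\<close>

lemma finite_unitary_divisors:
  assumes "A \<noteq> 0"
  shows "finite {d. unitary_divisor d A}"
proof -
  have "(UNIV :: bit set) \<subseteq> {0, 1}"
    by (auto intro: bit.exhaust)
  then have "finite (UNIV :: bit set)"
    by (rule finite_subset) simp
  then have "finite {xs :: bit list. set xs \<subseteq> UNIV \<and> length xs \<le> Suc (degree A)}"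
    by (rule finite_lists_length_le)
  then have "finite (Poly ` {xs :: bit list. set xs \<subseteq> UNIV \<and> length xs \<le> Suc (degree A)})"
    by (rule finite_imageI)
  moreover have "{d. unitary_divisor d A}
      \<subseteq> Poly ` {xs :: bit list. set xs \<subseteq> UNIV \<and> length xs \<le> Suc (degree A)}"
  proof
    fix d assume "d \<in> {d. unitary_divisor d A}"
    then have "d dvd A"
      by (simp add: unitary_divisor_def)
    then have "degree d \<le> degree A"
      using assms by (rule dvd_imp_degree_le)
    then have "length (coeffs d) \<le> Suc (degree A)"
      by (cases "d = 0") (simp_all add: length_coeffs_degree)
    then show "d \<in> Poly ` {xs :: bit list. set xs \<subseteq> UNIV \<and> length xs \<le> Suc (degree A)}"
      by (intro image_eqI[where x = "coeffs d"]) simp_all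
  qed
  ultimately show ?thesis
    by (rule finite_subset[rotated])
qed

definition unitary_perfect :: "bit poly \<Rightarrow> bool" where
  "unitary_perfect A \<longleftrightarrow> A \<noteq> 0 \<and> sigma_star A = A"

text \<open>
  Evenness of a polynomial refers to its zeros; it is unrelated to the parity predicate
  \<^const>\<open>even\<close> (divisibility by \<open>2 = 0\<close>).
\<close>

definition even_poly :: "bit poly \<Rightarrow> bool" where
  "even_poly A \<longleftrightarrow> (\<exists>a. poly A a = 0)"

definition odd_poly :: "bit poly \<Rightarrow> bool" where
  "odd_poly A \<longleftrightarrow> \<not> even_poly A"

end

theory Submission
  imports Defs "HOL-Library.Disjoint_Sets"
begin

text \<open>
  If \<open>A\<close> has no zero at \<open>c\<close>, then \<open>d c = 1\<close> for every unitary divisor \<open>d\<close> of \<open>A\<close>. The involution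
  \<open>d \<mapsto> A / d\<close> has no fixed point when \<open>A\<close> is nonconstant, so these values cancel in pairs and
  \<open>\<sigma>\<^sup>* A\<close> vanishes at \<open>c\<close>; hence \<open>\<sigma>\<^sup>* A \<noteq> A\<close>.
\<close>

lemma lead_coeff_bit:
  fixes p :: "bit poly"
  assumes "p \<noteq> 0"
  shows "lead_coeff p = 1"
  using assms by (metis bit_not_zero_iff leading_coeff_0_iff)

text \<open>Coprimality is symmetric in the two factors of \<open>A = d * (A div d)\<close>, so
  \<open>d\<close> and \<open>A div d\<close> can be interchanged.\<close>

lemma unitary_divisor_complement:
  assumes "A \<noteq> 0" "unitary_divisor d A"
  shows "unitary_divisor (A div d) A" and "A div (A div d) = d"
proof -
  have A: "A = d * (A div d)"
    using assms by (simp add: unitary_divisor_def)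
  with assms have nz: "A div d \<noteq> 0"
    by (metis mult_zero_right)
  show *: "A div (A div d) = d"
    using A nz by (metis nonzero_mult_div_cancel_right)
  show "unitary_divisor (A div d) A"
    unfolding unitary_divisor_def
  proof (intro conjI)
    show "A div d dvd A"
      using A by (metis dvd_triv_right)
    show "lead_coeff (A div d) = 1"
      using nz by (rule lead_coeff_bit)
    show "coprime (A div d) (A div (A div d))"
      using assms(2) by (simp add: * unitary_divisor_def coprime_commute)
  qed
qed

text \<open>A fixed point \<open>d\<close> would be coprime to itself, hence a unit, and then
  \<open>A = d * d\<close> would be constant.\<close>

lemma unitary_divisor_complement_neq:
  assumes "degree A > 0" "unitary_divisor d A"
  shows "A div d \<noteq> d"
proof
  assume eq: "A div d = d"
  then have "is_unit d"
    using assms(2) by (simp add: unitary_divisor_def)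
  moreover have "A = d * d"
    using assms(2) eq by (metis dvd_mult_div_cancel unitary_divisor_def)
  ultimately have "is_unit A"
    by (metis is_unit_mult_iff)
  with assms(1) show False
    by (metis degree_0 is_unit_iff_degree less_irrefl)
qed

lemma poly_sigma_star_eq_0:
  assumes "degree A > 0" "poly A c \<noteq> 0"
  shows "poly (sigma_star A) c = 0"
proof -
  have A: "A \<noteq> 0"
    using assms(1) by auto
  \<comment> \<open>\<open>poly d c\<close> is a factor of the nonzero value
    \<open>poly A c\<close>, and the only nonzero element of \<open>bit\<close> is 1.\<close>
  have one: "poly d c = 1" if "unitary_divisor d A" for d
    using that assms(2) by (metis bit_not_zero_iff dvd_mult_div_cancel mult_zero_left poly_mult unitary_divisor_def)
  have "(\<Sum>d | unitary_divisor d A. poly d c) = 0"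
  proof (rule sum_involution_eq_0[where h = "\<lambda>d. A div d"])
    fix d assume "d \<in> {d. unitary_divisor d A}"
    then have d: "unitary_divisor d A"
      by simp
    show "poly (A div d) c + poly d c = 0"
      using one[OF d] one[OF unitary_divisor_complement(1)[OF A d]] by simp
    show "A div d \<in> {d. unitary_divisor d A}" "A div (A div d) = d" "A div d \<noteq> d"
      using unitary_divisor_complement[OF A d] unitary_divisor_complement_neq[OF assms(1) d]
      by simp_all
  qed
  then show ?thesis
    by (simp add: sigma_star_def poly_sum)
qed

lemma unitary_perfect_poly_eq_0:
  assumes "degree A > 0" "unitary_perfect A"
  shows "poly A c = 0"
  using assms poly_sigma_star_eq_0 unfolding unitary_perfect_def by metis

theorem lemma2p9:
  shows "(\<forall>A :: bit poly. degree A > 0 \<and> unitary_perfect A \<longrightarrow> [:0, 1:] dvd A \<and> [:1, 1:] dvd A) \<and>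
         \<not> (\<exists>A :: bit poly. odd_poly A \<and> degree A > 0 \<and> unitary_perfect A)"
proof -
  have "[:0, 1:] dvd A \<and> [:1, 1:] dvd A" if "degree A > 0" "unitary_perfect A" for A :: "bit poly"
    using unitary_perfect_poly_eq_0[OF that, of 0] unitary_perfect_poly_eq_0[OF that, of 1]
    \<comment> \<open>A zero \<open>c\<close> gives the factor \<open>[:- c, 1:]\<close>; for
      \<open>c = 1\<close> this is \<open>[:1, 1:]\<close>, since \<open>- 1 = 1\<close> in
      \<open>bit\<close>.\<close>
    by (simp add: poly_eq_0_iff_dvd)
  then show ?thesis
    using unitary_perfect_poly_eq_0 by (auto simp: odd_poly_def even_poly_def)
qed

end
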